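(* Consider a network of $N$ parallel roads with mixed human-driven and autonomous traffic and flow demand $(\bar{x},\bar{y})$, all vehicles being selfish, such that $\mathrm{BNE}(\bar{x},\bar{y})\neq\emptyset$. Then there exists a road index $m^*_{\mathrm{EQ}}\in[N]$ such that every routing in $\mathrm{BNE}(\bar{x},\bar{y})$ satisfies the following properties with $m=m^*_{\mathrm{EQ}}$: (1) road $m$ is in free-flow; (2) every road with index less than $m$ is congested with latency $a_{m}$; (3) every road with index greater than $m$ has zero flow. Further, $m^*_{\mathrm{EQ}}$ is the minimum index $m\in[N]$ for which there is a feasible routing of the demand $(\bar{x},\bar{y})$ satisfying properties (1)-(3).
   Context: Network model. There are $N$ parallel roads (same origin and destination), indexed by $[N]=\{1,\dots,N\}$; $[m]=\{1,\dots,m\}$. Road $i$ has length $d_i>0$, free-flow speed $v^f_i>0$, maximum density $\rho^{\max}_i$, and nominal headways $\bar{h}_i\le h_i$ for autonomous and human-driven vehicles respectively; all vehicles have length $L>0$. Let $x_i,y_i\ge 0$ be the human-driven and autonomous flow on road $i$. The critical density is $$\rho^{\mathrm{crit}}_i(x_i,y_i)=\left(\frac{y_i}{x_i+y_i}\bar{h}_i+\frac{x_i}{x_i+y_i}h_i+L\right)^{-1},$$ with $\rho^{\mathrm{crit}}_i<\rho^{\max}_i$ always, and the maximum flow is $z^{\max}_i(x_i,y_i)=v^f_i\,\rho^{\mathrm{crit}}_i(x_i,y_i)$. The state $s_i\in\{0,1\}$ says whether road $i$ is in free-flow ($s_i=0$) or congested ($s_i=1$). The latency is $$\ell_i(x_i,y_i,s_i)=\begin{cases}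 d_i/v^f_i, & s_i=0,\\ d_i\left(\dfrac{\rho^{\max}_i}{x_i+y_i}+\dfrac{\rho^{\mathrm{crit}}_i(x_i,y_i)-\rho^{\max}_i}{z^{\max}_i(x_i,y_i)}\right), & s_i=1.\end{cases}$$ The free-flow latency is $a_i=d_i/v^f_i$; no two roads have equal free-flow latencies and roads are ordered so that $a_1<a_2<\dots<a_N$. A road with zero flow is in free-flow (latency $a_i$), and a road carrying exactly its maximum flow (where both formulas give $a_i$) is regarded as in free-flow. Routings. The demand $(\bar{x},\bar{y})$, $\bar{x},\bar{y}\ge 0$, is inelastic. A feasible routing of the demand is a triple $(\boldsymbol{x},\boldsymbol{y},\boldsymbol{s})\in\mathbb{R}^N_{\ge0}\times\mathbb{R}^N_{\ge0}\times\{0,1\}^N$ with $\sum_i x_i=\bar{x}$, $\sum_i y_i=\bar{y}$ and $x_i+y_i\le z^{\max}_i(x_i,y_i)$ on every road (trivially satisfied if $x_i+y_i=0$). Its total latency is $C(\boldsymbol{x},\boldsymbol{y},\boldsymbol{s})=\sum_{i\in[N]}(x_i+y_i)\ell_i(x_i,y_i,s_i)$. Nash equilibrium. A feasible routing is a Nash (Wardrop) Equilibrium if no vehicle can lower its travel time by unilaterally switching routes: $x_i+y_i>0$ implies $\ell_i(x_i,y_i,s_i)\le \ell_j(x_j,y_j,s_j)$ for all $j\in[N]$. The set of Best-case Nash Equilibria $\mathrm{BNE}(\bar{x},\bar{y})$ is the set of Nash Equilibria for the demand $(\bar{x},\bar{y})$ that minimize the total latency $C$ among Nash Equilibria for that demand.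 *)

theory Defs
  imports Complex_Main
begin

text \<open>
  Roads are the indices \<open>1, ..., N\<close>. Vectors in \<open>R^N\<close> are functions on \<^typ>\<open>nat\<close> of which
  only the values on these indices are ever used.
\<close>

record network =
  num_roads :: nat
  road_length :: "nat \<Rightarrow> real"
  ff_speed :: "nat \<Rightarrow> real"
  max_density :: "nat \<Rightarrow> real"
  headway_aut :: "nat \<Rightarrow> real"
  headway_hum :: "nat \<Rightarrow> real"
  veh_length :: real

definition roads :: "network \<Rightarrow> nat set" where
  "roads G = {1..num_roads G}"

definition crit_density :: "network \<Rightarrow> nat \<Rightarrow> real \<Rightarrow> real \<Rightarrow> real" where
  "crit_density G i x y =
     inverse (y / (x + y) * headway_aut G i + x / (x + y) * headway_hum G i + veh_length G)"

definition max_flow :: "network \<Rightarrow> nat \<Rightarrow> real \<Rightarrow> real \<Rightarrow> real" where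
  "max_flow G i x y = ff_speed G i * crit_density G i x y"

definition ff_latency :: "network \<Rightarrow> nat \<Rightarrow> real" where
  "ff_latency G i = road_length G i / ff_speed G i"

text \<open>The state is 0 for free-flow and 1 for congested.\<close>

definition latency :: "network \<Rightarrow> nat \<Rightarrow> real \<Rightarrow> real \<Rightarrow> nat \<Rightarrow> real" where
  "latency G i x y s =
     (if s = 0 then road_length G i / ff_speed G i
      else road_length G i *
        (max_density G i / (x + y) +
         (crit_density G i x y - max_density G i) / max_flow G i x y))"

text \<open>
  The critical density is compared with the maximum density only for nonzero flow: the fractions
  of vehicles of each kind are undefined on an empty road, and \<open>0 / 0 = 0\<close> would give the
  meaningless value \<open>1 / L\<close>.
\<close>

definition parallel_network :: "network \<Rightarrow> bool" where
  "parallel_network G \<longleftrightarrow>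
     num_roads G \<ge> 1 \<and> veh_length G > 0 \<and>
     (\<forall>i\<in>roads G.
        road_length G i > 0 \<and> ff_speed G i > 0 \<and>
        headway_aut G i \<le> headway_hum G i \<and>
        (\<forall>x y. x \<ge> 0 \<longrightarrow> y \<ge> 0 \<longrightarrow> x + y > 0 \<longrightarrow> crit_density G i x y < max_density G i)) \<and>
     (\<forall>i\<in>roads G. \<forall>j\<in>roads G. i < j \<longrightarrow> ff_latency G i < ff_latency G j)"

text \<open>Human-driven flows, autonomous flows, and states.\<close>

type_synonym routing = "(nat \<Rightarrow> real) \<times> (nat \<Rightarrow> real) \<times> (nat \<Rightarrow> nat)"

text \<open>
  The last condition on each road is the convention that empty roads and roads carrying exactly
  their maximum flow are in free-flow.
\<close>

definition feasible_routings :: "network \<Rightarrow> real \<Rightarrow> real \<Rightarrow> routing set" where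
  "feasible_routings G xbar ybar = {(x, y, s).
     (\<forall>i\<in>roads G.
        x i \<ge> 0 \<and> y i \<ge> 0 \<and> s i \<in> {0, 1} \<and>
        (x i + y i > 0 \<longrightarrow> x i + y i \<le> max_flow G i (x i) (y i)) \<and>
        (x i + y i = 0 \<or> x i + y i = max_flow G i (x i) (y i) \<longrightarrow> s i = 0)) \<and>
     (\<Sum>i\<in>roads G. x i) = xbar \<and> (\<Sum>i\<in>roads G. y i) = ybar}"

definition total_latency :: "network \<Rightarrow> routing \<Rightarrow> real" where
  "total_latency G = (\<lambda>(x, y, s). \<Sum>i\<in>roads G. (x i + y i) * latency G i (x i) (y i) (s i))"

definition nash_equilibria :: "network \<Rightarrow> real \<Rightarrow> real \<Rightarrow> routing set" where
  "nash_equilibria G xbar ybar = {(x, y, s).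
     (x, y, s) \<in> feasible_routings G xbar ybar \<and>
     (\<forall>i\<in>roads G. x i + y i > 0 \<longrightarrow>
        (\<forall>j\<in>roads G. latency G i (x i) (y i) (s i) \<le> latency G j (x j) (y j) (s j)))}"

definition BNE :: "network \<Rightarrow> real \<Rightarrow> real \<Rightarrow> routing set" where
  "BNE G xbar ybar = {r \<in> nash_equilibria G xbar ybar.
     \<forall>r'\<in>nash_equilibria G xbar ybar. total_latency G r \<le> total_latency G r'}"

definition free_flow_threshold :: "network \<Rightarrow> nat \<Rightarrow> routing \<Rightarrow> bool" where
  "free_flow_threshold G m = (\<lambda>(x, y, s).
     s m = 0 \<and>
     (\<forall>i\<in>roads G. i < m \<longrightarrow> s i = 1 \<and> latency G i (x i) (y i) (s i) = ff_latency G m) \<and>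
     (\<forall>i\<in>roads G. i > m \<longrightarrow> x i + y i = 0))"

end

theory Submission imports Defs begin

text \<open>
  After clearing denominators the model is linear. On a fixed road \<open>i\<close>, the congested
  latency of a flow \<open>(x, y)\<close> equals \<open>t\<close> exactly when a certain linear form in \<open>(x, y)\<close>, the \<open>load\<close>
  at level \<open>t\<close>, equals 1; the capacity constraint says that the load at level \<open>a\<^sub>i\<close> is at most 1.
  The coefficients of the load increase with \<open>t\<close>, so lowering the latency level relaxes every
  road at once (\<open>congested_latency_eq_iff\<close>, \<open>flow_le_max_flow_iff\<close>, \<open>load_mono\<close>).

  Let the demand be positive. In a Nash equilibrium all used roads have a common latency \<open>t\<close>. If \<open>M\<close> is the
  last used road, then \<open>t \<ge> a\<^sub>M\<close>, and every road before \<open>M\<close> must be congested, since in free-flow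
  it would have latency below \<open>a\<^sub>M\<close>. Hence all loads on the roads up to \<open>M\<close> are at
  most 1 at level \<open>a\<^sub>M\<close>. Now the flow of road \<open>M\<close> is used to top up the earlier roads to load exactly 1. Either
  this succeeds, giving a routing with properties (1)-(3) at \<open>M\<close>, or road \<open>M\<close> runs empty, and the same
  argument applies to the roads up to \<open>M - 1\<close> at the lower level \<open>a\<^bsub>M-1\<^esub>\<close>
  (\<open>redistribute_to_threshold\<close>). So some \<open>m \<le> M\<close> admits a routing with properties (1)-(3).

  Such a routing is itself a Nash equilibrium, with total latency \<open>a\<^sub>m\<close> times the demand
  (\<open>threshold_routing_nash\<close>). If the original equilibrium was a best one, then
  \<open>t \<le> a\<^sub>m \<le> a\<^sub>M \<le> t\<close>, so road \<open>M\<close> is in free-flow and the equilibrium has properties (1)-(3)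
  at \<open>M\<close> (\<open>BNE_threshold\<close>). Comparing total latencies shows that \<open>M\<close> is the same for all best
  equilibria and is minimal. For zero demand every road is empty and the index is 1.
\<close>

section \<open>Capacity and congested latency as linear conditions\<close>

text \<open>
  The nominal headways may be negative. On a road where even an all-autonomous flow has a positive space per vehicle,
  every mixture does, and the critical density is a genuine positive density; by
  \<open>usable_if_flow\<close> these are the only roads that can carry flow.
\<close>

definition usable :: "network \<Rightarrow> nat \<Rightarrow> bool" where
  "usable G i \<longleftrightarrow> headway_aut G i + veh_length G > 0"

text \<open>
  Writing \<open>z = x + y\<close> and \<open>W\<close> for the headway sum in the second summand, the congested latency is
  \<open>a\<^sub>i + d\<^sub>i \<rho>\<^sub>i (1 - W / v\<^sub>i) / z\<close>, where \<open>\<rho>\<^sub>i\<close> is the maximum density. Equating this to \<open>t\<close> and solving for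
  the constant 1 gives the linear form below.
\<close>

definition load :: "network \<Rightarrow> real \<Rightarrow> nat \<Rightarrow> real \<Rightarrow> real \<Rightarrow> real" where
  "load G t i x y =
     (t - ff_latency G i) / (road_length G i * max_density G i) * (x + y)
     + ((headway_aut G i + veh_length G) * y + (headway_hum G i + veh_length G) * x) / ff_speed G i"

lemma network_road:
  assumes "parallel_network G" "i \<in> roads G"
  shows "road_length G i > 0" "ff_speed G i > 0" "headway_aut G i \<le> headway_hum G i"
    and "x \<ge> 0 \<Longrightarrow> y \<ge> 0 \<Longrightarrow> x + y > 0 \<Longrightarrow> crit_density G i x y < max_density G i"
  using assms unfolding parallel_network_def by blast+

lemma ff_latency_less_iff:
  assumes "parallel_network G" "i \<in> roads G" "j \<in> roads G"
  shows "ff_latency G i < ff_latency G j \<longleftrightarrow> i < j"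
  using assms unfolding parallel_network_def by (metis linorder_less_linear order_less_asym order_less_irrefl)

lemma ff_latency_le_iff:
  assumes "parallel_network G" "i \<in> roads G" "j \<in> roads G"
  shows "ff_latency G i \<le> ff_latency G j \<longleftrightarrow> i \<le> j"
  using ff_latency_less_iff[of G j i] assms by (simp add: not_less[symmetric])

lemma max_density_pos:
  assumes "parallel_network G" "i \<in> roads G" "usable G i"
  shows "max_density G i > 0"
proof -
  have "0 < crit_density G i 0 1" using assms(3) by (simp add: crit_density_def usable_def)
  also have "\<dots> < max_density G i" using network_road(4)[OF assms(1,2), of 0 1] by simp
  finally show ?thesis .
qed

lemma crit_density_eq:
  assumes "x + y > 0"
  shows "crit_density G i x y = (x + y) /
    ((headway_aut G i + veh_length G) * y + (headway_hum G i + veh_length G) * x)"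
proof -
  have "y / (x + y) * headway_aut G i + x / (x + y) * headway_hum G i + veh_length G
     = ((headway_aut G i + veh_length G) * y + (headway_hum G i + veh_length G) * x) / (x + y)"
  proof -
    have "(headway_aut G i + veh_length G) * y + (headway_hum G i + veh_length G) * x
        = y * headway_aut G i + x * headway_hum G i + veh_length G * (x + y)"
      by (simp add: algebra_simps)
    then show ?thesis using assms by (simp add: add_divide_distrib)
  qed
  then show ?thesis by (simp add: crit_density_def)
qed

lemma headway_sum_pos:
  assumes "parallel_network G" "i \<in> roads G" "usable G i" "x \<ge> 0" "y \<ge> 0" "x + y > 0"
  shows "(headway_aut G i + veh_length G) * y + (headway_hum G i + veh_length G) * x > 0"
proof -
  have "0 < (headway_aut G i + veh_length G) * (x + y)"
    using assms by (simp add: usable_def)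
  also have "\<dots> \<le> (headway_aut G i + veh_length G) * y + (headway_hum G i + veh_length G) * x"
    using mult_right_mono[OF network_road(3)[OF assms(1,2)] assms(4)] by (simp add: algebra_simps)
  finally show ?thesis .
qed

text \<open>
  If the critical density is positive for one mixture but the spacing of autonomous vehicles is
  not, then the spacing, being affine in the mixture, takes arbitrarily small positive values; its
  inverse would then exceed the maximum density.
\<close>

lemma usable_if_flow:
  assumes G: "parallel_network G" "i \<in> roads G"
    and xy: "x \<ge> 0" "y \<ge> 0" "x + y > 0" and cap: "x + y \<le> max_flow G i x y"
  shows "usable G i"
proof (rule ccontr)
  assume "\<not> usable G i"
  define A where "A = headway_aut G i + veh_length G"
  define H where "H = headway_hum G i + veh_length G"
  have A: "A \<le> 0" using \<open>\<not> usable G i\<close> by (simp add: A_def usable_def)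
  have "0 < ff_speed G i * crit_density G i x y" using xy cap by (simp add: max_flow_def)
  then have crit: "crit_density G i x y > 0"
    using network_road(2)[OF G] by (simp add: zero_less_mult_iff)
  then have "A * y + H * x > 0"
    using xy by (simp add: crit_density_eq A_def H_def zero_less_divide_iff)
  moreover have "A * y \<le> 0" using A xy by (simp add: mult_nonpos_nonneg)
  ultimately have "H * x > 0" by linarith
  then have H: "H > 0" using xy by (simp add: zero_less_mult_iff)
  have R: "max_density G i > 0" using crit network_road(4)[OF G xy] by simp
  \<comment> \<open>A spacing so small that its inverse is at least the maximum density, and the fraction \<open>b\<close> of human-driven vehicles that realizes it.\<close>
  define c where "c = min H (1 / max_density G i)"
  have c: "c > 0" "c \<le> H" "c \<le> 1 / max_density G i" using H R by (auto simp: c_def)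
  define b where "b = (c - A) / (H - A)"
  have b: "0 \<le> b" "b \<le> 1" using A H c by (auto simp: b_def)
  have bc: "A * (1 - b) + H * b = c"
  proof -
    have "A * (1 - b) + H * b = A + b * (H - A)" by (simp add: algebra_simps)
    then show ?thesis using A H by (simp add: b_def)
  qed
  have "crit_density G i b (1 - b) = 1 / c"
    using bc by (simp add: crit_density_eq A_def H_def)
  moreover have "crit_density G i b (1 - b) < max_density G i"
    using network_road(4)[OF G, of b "1 - b"] b by simp
  moreover have "1 / c \<ge> max_density G i"
    using c R by (simp add: field_simps)
  ultimately show False by simp
qed

lemma load_ff_latency:
  "load G (ff_latency G i) i x y =
    ((headway_aut G i + veh_length G) * y + (headway_hum G i + veh_length G) * x) / ff_speed G i"
  by (simp add: load_def)

lemma load_add: "load G t i (x + c * x') (y + c * y') = load G t i x y + c * load G t i x' y'"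
  by (simp add: load_def divide_inverse) (simp add: algebra_simps)

lemma load_strict_mono:
  assumes "parallel_network G" "i \<in> roads G" "usable G i" "x + y > 0" "t < t'"
  shows "load G t i x y < load G t' i x y"
  unfolding load_def
  using assms max_density_pos[OF assms(1-3)] network_road[OF assms(1,2)]
  by (intro add_strict_right_mono mult_strict_right_mono divide_strict_right_mono) auto

lemma load_zero: "load G t i 0 0 = 0"
  by (simp add: load_def)

lemma load_mono:
  assumes "parallel_network G" "i \<in> roads G" "usable G i" "x \<ge> 0" "y \<ge> 0" "t \<le> t'"
  shows "load G t i x y \<le> load G t' i x y"
proof (cases "x + y > 0 \<and> t < t'")
  case True
  then show ?thesis using load_strict_mono assms by (simp add: less_imp_le)
next
  case False
  then have "(x = 0 \<and> y = 0) \<or> t = t'" using assms by linarith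
  then show ?thesis by (auto simp: load_zero)
qed

lemma load_pos:
  assumes "parallel_network G" "i \<in> roads G" "usable G i" "x \<ge> 0" "y \<ge> 0" "x + y > 0"
    and "ff_latency G i \<le> t"
  shows "load G t i x y > 0"
proof -
  have "0 < load G (ff_latency G i) i x y"
    unfolding load_ff_latency
    using headway_sum_pos[OF assms(1-6)] network_road(2)[OF assms(1,2)] by simp
  also have "\<dots> \<le> load G t i x y" using load_mono assms by blast
  finally show ?thesis .
qed

lemma max_flow_eq_load:
  assumes "parallel_network G" "i \<in> roads G" "usable G i" "x \<ge> 0" "y \<ge> 0" "x + y > 0"
  shows "max_flow G i x y = (x + y) / load G (ff_latency G i) i x y"
  unfolding max_flow_def crit_density_eq[OF assms(6)] load_ff_latency
  using network_road(2)[OF assms(1,2)] by simp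

lemma
  assumes "parallel_network G" "i \<in> roads G" "usable G i" "x \<ge> 0" "y \<ge> 0" "x + y > 0"
  shows flow_le_max_flow_iff: "x + y \<le> max_flow G i x y \<longleftrightarrow> load G (ff_latency G i) i x y \<le> 1"
    and flow_eq_max_flow_iff: "x + y = max_flow G i x y \<longleftrightarrow> load G (ff_latency G i) i x y = 1"
proof -
  have p: "load G (ff_latency G i) i x y > 0" using load_pos assms by blast
  show "x + y \<le> max_flow G i x y \<longleftrightarrow> load G (ff_latency G i) i x y \<le> 1"
    unfolding max_flow_eq_load[OF assms] using p assms(6) by (simp add: pos_le_divide_eq mult_le_cancel_left1)
  show "x + y = max_flow G i x y \<longleftrightarrow> load G (ff_latency G i) i x y = 1"
    unfolding max_flow_eq_load[OF assms] using p assms(6) by (auto simp: eq_divide_eq)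
qed

lemma congested_latency_eq_iff:
  assumes "parallel_network G" "i \<in> roads G" "usable G i" "x \<ge> 0" "y \<ge> 0" "x + y > 0"
    and "s \<noteq> 0"
  shows "latency G i x y s = t \<longleftrightarrow> load G t i x y = 1"
proof -
  define W where "W = (headway_aut G i + veh_length G) * y + (headway_hum G i + veh_length G) * x"
  define d v R z where "d = road_length G i" and "v = ff_speed G i" and "R = max_density G i"
    and "z = x + y"
  have pos: "W > 0" "d > 0" "v > 0" "R > 0" "z > 0"
    using headway_sum_pos[OF assms(1-6)] network_road[OF assms(1,2)] max_density_pos[OF assms(1-3)] assms(6)
    by (auto simp: W_def d_def v_def R_def z_def)
  have crit: "crit_density G i x y = z / W"
    using crit_density_eq[OF assms(6)] by (simp add: W_def z_def)
  have "latency G i x y s = d / v + d * R / z * (1 - W / v)"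
    using pos assms(7) unfolding latency_def max_flow_def crit
    unfolding d_def[symmetric] v_def[symmetric] R_def[symmetric] z_def[symmetric]
    by (simp add: field_simps)
  moreover have "load G t i x y = (t - d / v) / (d * R) * z + W / v"
    by (simp add: load_def ff_latency_def W_def d_def v_def R_def z_def)
  moreover have "d / v + d * R / z * (1 - W / v) = t \<longleftrightarrow> (t - d / v) / (d * R) * z + W / v = 1"
  proof -
    have "(t - d / v) / (d * R) * z + W / v = 1 \<longleftrightarrow> (t - d / v) / (d * R) * z = 1 - W / v"
      by linarith
    also have "\<dots> \<longleftrightarrow> t - d / v = d * R / z * (1 - W / v)"
    proof -
      define u where "u = t - d / v"
      define k where "k = 1 - W / v"
      have "u / (d * R) * z = k \<longleftrightarrow> u = d * R / z * k"
        using pos by (auto simp: field_simps)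
      then show ?thesis by (simp add: u_def k_def)
    qed
    finally show ?thesis by linarith
  qed
  ultimately show ?thesis by simp
qed

lemma latency_free: "latency G i x y 0 = ff_latency G i"
  by (simp add: latency_def ff_latency_def)

lemma feasibleD:
  assumes "(x, y, s) \<in> feasible_routings G xbar ybar" "i \<in> roads G"
  shows "x i \<ge> 0" "y i \<ge> 0" "s i = 0 \<or> s i = 1"
    and "x i + y i > 0 \<Longrightarrow> x i + y i \<le> max_flow G i (x i) (y i)"
    and "x i + y i = 0 \<or> x i + y i = max_flow G i (x i) (y i) \<Longrightarrow> s i = 0"
  using assms unfolding feasible_routings_def by auto

lemma feasible_total:
  assumes "(x, y, s) \<in> feasible_routings G xbar ybar"
  shows "(\<Sum>i\<in>roads G. x i + y i) = xbar + ybar"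
  using assms unfolding feasible_routings_def by (auto simp: sum.distrib)

text \<open>
  A congested road is neither empty nor at capacity, so its load at level \<open>a\<^sub>i\<close> is strictly below 1,
  while at its own latency it is 1; monotonicity then separates the two levels.
\<close>

lemma ff_latency_less_congested:
  assumes G: "parallel_network G" "i \<in> roads G"
    and f: "(x, y, s) \<in> feasible_routings G xbar ybar" and s: "s i = 1"
  shows "x i + y i > 0" "usable G i" "ff_latency G i < latency G i (x i) (y i) (s i)"
proof -
  note F = feasibleD[OF f G(2)]
  show z: "x i + y i > 0" using F(1,2,5) s by (metis add_nonneg_nonneg less_eq_real_def zero_neq_one)
  show u: "usable G i" using usable_if_flow[OF G F(1,2) z F(4)[OF z]] .
  define t where "t = latency G i (x i) (y i) (s i)"
  have "load G t i (x i) (y i) = 1"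
    using congested_latency_eq_iff[OF G u F(1,2) z, of "s i" t] s by (simp add: t_def)
  moreover have "load G (ff_latency G i) i (x i) (y i) \<noteq> 1"
    using flow_eq_max_flow_iff[OF G u F(1,2) z] F(5) s by auto
  moreover have "load G (ff_latency G i) i (x i) (y i) \<le> 1"
    using flow_le_max_flow_iff[OF G u F(1,2) z] F(4)[OF z] by auto
  ultimately show "ff_latency G i < t"
    using load_mono[OF G u F(1,2), of t "ff_latency G i"] by (cases "ff_latency G i < t") auto
qed

lemma ff_latency_le_latency:
  assumes "parallel_network G" "i \<in> roads G" "(x, y, s) \<in> feasible_routings G xbar ybar"
  shows "ff_latency G i \<le> latency G i (x i) (y i) (s i)"
  using feasibleD(3)[OF assms(3,2)] ff_latency_less_congested(3)[OF assms] by (auto simp: latency_free)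

section \<open>Topping up the earlier roads\<close>

text \<open>
  At level \<open>a\<^sub>M\<close>, a fraction \<open>c\<^sub>i\<close> of the flow \<open>(X, Y)\<close> of road \<open>M\<close> would fill the remaining slack of
  road \<open>i\<close>. Moving fixed fractions keeps the mixture on \<open>M\<close> constant, so the human-driven and the autonomous
  demand are preserved together. If the fractions sum to at most 1, all earlier roads can be filled.
  Otherwise the fractions are scaled down to sum to 1, which empties road \<open>M\<close> without overfilling any other
  road, and the induction continues with \<open>M - 1\<close>, whose lower level only decreases the loads.
\<close>

lemma redistribute_to_threshold:
  assumes "parallel_network G" and "M \<in> roads G"
    and "\<forall>i\<in>{1..M}. usable G i"
    and "\<forall>i\<in>{1..M}. 0 \<le> x i \<and> 0 \<le> y i \<and> load G (ff_latency G M) i (x i) (y i) \<le> 1"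
  shows "\<exists>m\<in>{1..M}. \<exists>x' y'.
    (\<forall>i\<in>{1..m}. 0 \<le> x' i \<and> 0 \<le> y' i \<and> load G (ff_latency G m) i (x' i) (y' i) \<le> 1) \<and>
    (\<forall>i\<in>{1..<m}. load G (ff_latency G m) i (x' i) (y' i) = 1) \<and>
    sum x' {1..m} = sum x {1..M} \<and> sum y' {1..m} = sum y {1..M}"
  using assms
proof (induction M arbitrary: x y)
  case 0
  then show ?case by (simp add: roads_def)
next
  case (Suc n)
  note G = \<open>parallel_network G\<close>
  let ?M = "Suc n"
  let ?t = "ff_latency G ?M"
  have road: "i \<in> roads G" if "i \<in> {1..?M}" for i
    using that \<open>?M \<in> roads G\<close> by (auto simp: roads_def)
  show ?case
  proof (cases "n = 0")
    case True
    then show ?thesis using Suc.prems(4) by (intro bexI[of _ 1] exI[of _ x] exI[of _ y]) auto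
  next
    case False
    \<comment> \<open>Once road \<open>M\<close> is empty, the induction hypothesis applies.\<close>
    have descend: ?thesis
      if x': "\<forall>i\<in>{1..n}. 0 \<le> x' i \<and> 0 \<le> y' i \<and> load G ?t i (x' i) (y' i) \<le> 1"
        and sums: "sum x' {1..n} = sum x {1..?M}" "sum y' {1..n} = sum y {1..?M}" for x' y'
    proof -
      have "load G (ff_latency G n) i (x' i) (y' i) \<le> 1" if i: "i \<in> {1..n}" for i
      proof -
        have "ff_latency G n \<le> ?t" using ff_latency_le_iff[OF G road road] False by auto
        then have "load G (ff_latency G n) i (x' i) (y' i) \<le> load G ?t i (x' i) (y' i)"
          using x' i Suc.prems(3) by (intro load_mono[OF G road]) auto
        then show ?thesis using x' i by fastforce
      qed
      then obtain m x'' y'' where "m \<in> {1..n}"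
        "(\<forall>i\<in>{1..m}. 0 \<le> x'' i \<and> 0 \<le> y'' i \<and> load G (ff_latency G m) i (x'' i) (y'' i) \<le> 1) \<and>
         (\<forall>i\<in>{1..<m}. load G (ff_latency G m) i (x'' i) (y'' i) = 1) \<and>
         sum x'' {1..m} = sum x' {1..n} \<and> sum y'' {1..m} = sum y' {1..n}"
        using Suc.IH[OF G, of x' y'] road[of n] False Suc.prems(3) x' by auto
      then show ?thesis using sums by (intro bexI[of _ m] exI[of _ x''] exI[of _ y'']) auto
    qed
    define X Y where "X = x ?M" and "Y = y ?M"
    have XY: "X \<ge> 0" "Y \<ge> 0" "load G ?t ?M X Y \<le> 1" using Suc.prems(4) by (auto simp: X_def Y_def)
    show ?thesis
    proof (cases "X + Y > 0")
      case False
      then have "X = 0" "Y = 0" using XY by auto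
      then show ?thesis using Suc.prems(4) by (intro descend[of x y]) (auto simp: X_def Y_def)
    next
      case True
      define c where "c i = (1 - load G ?t i (x i) (y i)) / load G ?t i X Y" for i
      define S where "S = (\<Sum>i\<in>{1..n}. c i)"
      have w: "load G ?t i X Y > 0" if "i \<in> {1..?M}" for i
        using that Suc.prems(3) XY True ff_latency_le_iff[OF G road[OF that] road[of ?M]]
        by (intro load_pos[OF G road]) auto
      have c0: "c i \<ge> 0" if "i \<in> {1..n}" for i
        using that w[of i] Suc.prems(4) by (auto simp: c_def)
      have shifted: "load G ?t i (x i + k * c i * X) (y i + k * c i * Y)
          = load G ?t i (x i) (y i) + k * (1 - load G ?t i (x i) (y i))" if "i \<in> {1..n}" for k i
        unfolding load_add using w[of i] that by (simp add: c_def)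
      show ?thesis
      proof (cases "S \<le> 1")
        case True
        define x' where "x' i = (if i = ?M then (1 - S) * X else x i + c i * X)" for i
        define y' where "y' i = (if i = ?M then (1 - S) * Y else y i + c i * Y)" for i
        have full: "load G ?t i (x' i) (y' i) = 1" if "i \<in> {1..n}" for i
          using shifted[OF that, of 1] that by (auto simp: x'_def y'_def)
        have "load G ?t ?M (x' ?M) (y' ?M) = (1 - S) * load G ?t ?M X Y"
          using load_add[of G ?t ?M 0 "1 - S" X 0 Y] by (simp add: x'_def y'_def load_zero)
        also have "\<dots> \<le> 1"
        proof -
          have "S \<ge> 0" unfolding S_def by (intro sum_nonneg c0)
          then show ?thesis using XY(3) w[of ?M] True by (intro mult_le_one) auto
        qed
        finally have last: "load G ?t ?M (x' ?M) (y' ?M) \<le> 1" .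
        have nonneg: "0 \<le> x' i \<and> 0 \<le> y' i" if "i \<in> {1..?M}" for i
          using that Suc.prems(4) XY True c0[of i] by (auto simp: x'_def y'_def le_Suc_eq)
        have "sum x' {1..?M} = (\<Sum>i\<in>{1..n}. x i + c i * X) + (1 - S) * X"
          by (simp add: x'_def)
        also have "\<dots> = sum x {1..?M}"
          by (simp add: sum.distrib S_def sum_distrib_right[symmetric] X_def algebra_simps)
        finally have sx: "sum x' {1..?M} = sum x {1..?M}" .
        have "sum y' {1..?M} = (\<Sum>i\<in>{1..n}. y i + c i * Y) + (1 - S) * Y"
          by (simp add: y'_def)
        also have "\<dots> = sum y {1..?M}"
          by (simp add: sum.distrib S_def sum_distrib_right[symmetric] Y_def algebra_simps)
        finally have sy: "sum y' {1..?M} = sum y {1..?M}" .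
        have "load G ?t i (x' i) (y' i) \<le> 1" if "i \<in> {1..?M}" for i
          using that full[of i] last by (cases "i = ?M") auto
        then show ?thesis
          using nonneg full sx sy by (intro bexI[of _ ?M] exI[of _ x'] exI[of _ y']) auto
      next
        case False
        define k where "k = 1 / S"
        have k: "0 \<le> k" "k \<le> 1" "k * S = 1" using False by (auto simp: k_def)
        have sc: "(\<Sum>i\<in>{1..n}. k * c i * z) = z" for z
          using k(3) by (simp add: S_def sum_distrib_left[symmetric] sum_distrib_right[symmetric])
        show ?thesis
        proof (rule descend[of "\<lambda>i. x i + k * c i * X" "\<lambda>i. y i + k * c i * Y"])
          show "(\<Sum>i\<in>{1..n}. x i + k * c i * X) = sum x {1..?M}"
            "(\<Sum>i\<in>{1..n}. y i + k * c i * Y) = sum y {1..?M}"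
            using sc by (simp_all add: sum.distrib X_def Y_def)
          show "\<forall>i\<in>{1..n}. 0 \<le> x i + k * c i * X \<and> 0 \<le> y i + k * c i * Y \<and>
            load G ?t i (x i + k * c i * X) (y i + k * c i * Y) \<le> 1"
          proof (intro ballI conjI)
            fix i assume i: "i \<in> {1..n}"
            show "0 \<le> x i + k * c i * X" "0 \<le> y i + k * c i * Y"
              using i k c0[OF i] XY Suc.prems(4) by auto
            have "load G ?t i (x i) (y i) \<le> 1" using i Suc.prems(4) by auto
            then have "k * (1 - load G ?t i (x i) (y i)) \<le> 1 - load G ?t i (x i) (y i)"
              using k by (intro mult_left_le_one_le) auto
            then show "load G ?t i (x i + k * c i * X) (y i + k * c i * Y) \<le> 1"
              using shifted[OF i, of k] by simp
          qed
        qed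
      qed
    qed
  qed
qed

section \<open>Routings with properties (1)-(3) as equilibria\<close>

text \<open>
  The loads of \<open>redistribute_to_threshold\<close> are taken at the common level \<open>a\<^sub>m\<close>, the capacities at each
  road's own \<open>a\<^sub>i\<close>. For \<open>i < m\<close> the latter load is strictly below 1: such a road is strictly below capacity, and thus
  may be declared congested.
\<close>

lemma feasible_threshold_routing:
  assumes G: "parallel_network G" and m: "m \<in> roads G"
    and us: "\<forall>i\<in>{1..m}. usable G i"
    and xy: "\<forall>i\<in>{1..m}. 0 \<le> x i \<and> 0 \<le> y i \<and> load G (ff_latency G m) i (x i) (y i) \<le> 1"
    and full: "\<forall>i\<in>{1..<m}. load G (ff_latency G m) i (x i) (y i) = 1"
  shows "\<exists>r\<in>feasible_routings G (sum x {1..m}) (sum y {1..m}). free_flow_threshold G m r"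
proof -
  define x' where "x' i = (if i \<le> m then x i else 0)" for i
  define y' where "y' i = (if i \<le> m then y i else 0)" for i
  define s :: "nat \<Rightarrow> nat" where "s i = (if i < m then 1 else 0)" for i
  have sums: "sum x' (roads G) = sum x {1..m}" "sum y' (roads G) = sum y {1..m}"
    using m by (auto simp: x'_def y'_def roads_def intro!: sum.mono_neutral_cong_right)
  have below: "x i + y i > 0 \<and> load G (ff_latency G i) i (x i) (y i) < 1 \<and>
      latency G i (x i) (y i) 1 = ff_latency G m" if i: "i \<in> roads G" "i < m" for i
  proof -
    have i': "i \<in> {1..<m}" "i \<in> {1..m}" using i by (auto simp: roads_def)
    then have nn: "x i \<ge> 0" "y i \<ge> 0" and u: "usable G i" and l: "load G (ff_latency G m) i (x i) (y i) = 1"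
      using xy us full by auto
    have "x i + y i \<noteq> 0"
    proof
      assume "x i + y i = 0"
      then have "x i = 0" "y i = 0" using nn by auto
      then show False using l by (simp add: load_zero)
    qed
    then have z: "x i + y i > 0" using nn by simp
    then show ?thesis
      using load_strict_mono[OF G i(1) u z, of "ff_latency G i" "ff_latency G m"]
        ff_latency_less_iff[OF G i(1) m] i(2) l congested_latency_eq_iff[OF G i(1) u nn z] by auto
  qed
  have feas: "(x', y', s) \<in> feasible_routings G (sum x {1..m}) (sum y {1..m})"
    unfolding feasible_routings_def mem_Collect_eq prod.case
  proof (intro conjI ballI impI sums)
    fix i assume i: "i \<in> roads G"
    show "0 \<le> x' i" "0 \<le> y' i" "s i \<in> {0, 1}"
      using i xy by (auto simp: x'_def y'_def s_def roads_def)
    show "x' i + y' i \<le> max_flow G i (x' i) (y' i)" if z: "0 < x' i + y' i"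
    proof -
      have im: "i \<in> {1..m}" using z i by (auto simp: x'_def y'_def roads_def split: if_splits)
      then have z': "x i + y i > 0" "x i \<ge> 0" "y i \<ge> 0" "usable G i"
        using z us xy by (auto simp: x'_def y'_def)
      have "load G (ff_latency G i) i (x i) (y i) \<le> 1"
      proof (cases "i = m")
        case True then show ?thesis using xy im by auto
      next
        case False then show ?thesis using below[OF i] im by auto
      qed
      then show ?thesis
        using flow_le_max_flow_iff[OF G i z'(4,2,3,1)] im by (simp add: x'_def y'_def)
    qed
    show "s i = 0" if e: "x' i + y' i = 0 \<or> x' i + y' i = max_flow G i (x' i) (y' i)"
    proof (rule ccontr)
      assume "s i \<noteq> 0"
      then have im: "i < m" by (auto simp: s_def split: if_splits)
      then have "i \<in> {1..m}" using i by (auto simp: roads_def)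
      then show False
        using e below[OF i im] flow_eq_max_flow_iff[OF G i, of "x i" "y i"] us xy im
        by (auto simp: x'_def y'_def)
    qed
  qed
  moreover have "free_flow_threshold G m (x', y', s)"
    using below by (auto simp: free_flow_threshold_def x'_def y'_def s_def)
  ultimately show ?thesis by blast
qed

lemma threshold_routing_latency:
  assumes G: "parallel_network G" and m: "m \<in> roads G"
    and f: "(x, y, s) \<in> feasible_routings G xbar ybar"
    and th: "free_flow_threshold G m (x, y, s)" and i: "i \<in> roads G"
  shows "ff_latency G m \<le> latency G i (x i) (y i) (s i)"
    and "x i + y i > 0 \<Longrightarrow> latency G i (x i) (y i) (s i) = ff_latency G m"
proof -
  consider "i < m" | "i = m" | "i > m" by linarith
  then have "ff_latency G m \<le> latency G i (x i) (y i) (s i) \<and>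
    (x i + y i > 0 \<longrightarrow> latency G i (x i) (y i) (s i) = ff_latency G m)"
  proof cases
    case 3
    then show ?thesis
      using th i ff_latency_le_latency[OF G i f] ff_latency_less_iff[OF G m i]
      by (auto simp: free_flow_threshold_def)
  qed (use th i in \<open>auto simp: free_flow_threshold_def latency_free\<close>)
  then show "ff_latency G m \<le> latency G i (x i) (y i) (s i)"
    and "x i + y i > 0 \<Longrightarrow> latency G i (x i) (y i) (s i) = ff_latency G m" by auto
qed

lemma total_latency_common:
  assumes f: "(x, y, s) \<in> feasible_routings G xbar ybar"
    and l: "\<And>i. i \<in> roads G \<Longrightarrow> x i + y i > 0 \<Longrightarrow> latency G i (x i) (y i) (s i) = t"
  shows "total_latency G (x, y, s) = t * (xbar + ybar)"
proof -
  have "total_latency G (x, y, s) = (\<Sum>i\<in>roads G. t * (x i + y i))"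
    unfolding total_latency_def prod.case
  proof (rule sum.cong)
    fix i assume i: "i \<in> roads G"
    show "(x i + y i) * latency G i (x i) (y i) (s i) = t * (x i + y i)"
      using l[OF i] feasibleD(1,2)[OF f i] by (cases "x i + y i = 0") auto
  qed simp
  then show ?thesis using feasible_total[OF f] by (simp add: sum_distrib_left[symmetric])
qed

lemma threshold_routing_nash:
  assumes "parallel_network G" "m \<in> roads G" "r \<in> feasible_routings G xbar ybar"
    and "free_flow_threshold G m r"
  shows "r \<in> nash_equilibria G xbar ybar"
    and "total_latency G r = ff_latency G m * (xbar + ybar)"
proof -
  obtain x y s where r: "r = (x, y, s)" by (cases r)
  note L = threshold_routing_latency[OF assms(1,2) assms(3)[unfolded r] assms(4)[unfolded r]]
  show "r \<in> nash_equilibria G xbar ybar"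
    using assms(3) L unfolding nash_equilibria_def r by auto
  show "total_latency G r = ff_latency G m * (xbar + ybar)"
    unfolding r using assms(3) L r by (intro total_latency_common) auto
qed

section \<open>Best-case equilibria\<close>

text \<open>
  The road \<open>M\<close> obtained is the last used one. A road \<open>i < M\<close> in free-flow would offer the drivers on
  \<open>M\<close> the latency \<open>a\<^sub>i < a\<^sub>M\<close>.
\<close>

lemma nash_structure:
  assumes G: "parallel_network G" and D: "xbar + ybar > 0"
    and ne: "(x, y, s) \<in> nash_equilibria G xbar ybar"
  obtains M where "M \<in> roads G" "x M + y M > 0"
    "\<And>i. i \<in> roads G \<Longrightarrow> i > M \<Longrightarrow> x i + y i = 0"
    "\<And>i. i \<in> roads G \<Longrightarrow> i < M \<Longrightarrow> s i = 1"
    "\<And>i. i \<in> roads G \<Longrightarrow> i \<le> M \<Longrightarrow> x i + y i > 0"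
    "\<And>i. i \<in> roads G \<Longrightarrow> x i + y i > 0 \<Longrightarrow>
      latency G i (x i) (y i) (s i) = latency G M (x M) (y M) (s M)"
proof -
  have f: "(x, y, s) \<in> feasible_routings G xbar ybar" using ne by (auto simp: nash_equilibria_def)
  have opt: "latency G i (x i) (y i) (s i) \<le> latency G j (x j) (y j) (s j)"
    if "i \<in> roads G" "j \<in> roads G" "x i + y i > 0" for i j
    using ne that by (auto simp: nash_equilibria_def)
  define U where "U = {i \<in> roads G. x i + y i > 0}"
  have fin: "finite U" by (simp add: U_def roads_def)
  have "U \<noteq> {}"
  proof
    assume "U = {}"
    then have "(\<Sum>i\<in>roads G. x i + y i) \<le> 0" by (intro sum_nonpos) (auto simp: U_def)
    then show False using D feasible_total[OF f] by simp
  qed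
  define M where "M = Max U"
  have MU: "M \<in> U" "\<And>i. i \<in> U \<Longrightarrow> i \<le> M" using Max_in[OF fin \<open>U \<noteq> {}\<close>] fin by (auto simp: M_def)
  then have M: "M \<in> roads G" "x M + y M > 0" by (auto simp: U_def)
  have cong: "s i = 1" if i: "i \<in> roads G" "i < M" for i
  proof (rule ccontr)
    assume "s i \<noteq> 1"
    then have "latency G i (x i) (y i) (s i) = ff_latency G i"
      using feasibleD(3)[OF f i(1)] by (auto simp: latency_free)
    then show False
      using opt[OF M(1) i(1) M(2)] ff_latency_le_latency[OF G M(1) f] ff_latency_less_iff[OF G i(1) M(1)] i(2)
      by auto
  qed
  show thesis
  proof (rule that[OF M])
    show "x i + y i = 0" if i: "i \<in> roads G" "i > M" for i
      using MU(2)[of i] feasibleD(1,2)[OF f i(1)] i by (force simp: U_def)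
    show "s i = 1" if "i \<in> roads G" "i < M" for i using cong that .
    show "x i + y i > 0" if "i \<in> roads G" "i \<le> M" for i
      using that M(2) ff_latency_less_congested(1)[OF G that(1) f] cong[of i] by (cases "i = M") auto
    show "latency G i (x i) (y i) (s i) = latency G M (x M) (y M) (s M)"
      if "i \<in> roads G" "x i + y i > 0" for i
      using opt[OF that(1) M(1) that(2)] opt[OF M(1) that(1) M(2)] by simp
  qed
qed

text \<open>
  Road \<open>M\<close> itself may be in either state: within its capacity, its load at level \<open>a\<^sub>M\<close> is at most 1.
\<close>

lemma threshold_routing_from_congested:
  assumes G: "parallel_network G" and f: "(x, y, s) \<in> feasible_routings G xbar ybar"
    and M: "M \<in> roads G"
    and above: "\<And>i. i \<in> roads G \<Longrightarrow> i > M \<Longrightarrow> x i + y i = 0"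
    and below: "\<And>i. i \<in> roads G \<Longrightarrow> i < M \<Longrightarrow> s i = 1"
    and flow: "\<And>i. i \<in> roads G \<Longrightarrow> i \<le> M \<Longrightarrow> x i + y i > 0"
    and lat: "\<And>i. i \<in> roads G \<Longrightarrow> i < M \<Longrightarrow> ff_latency G M \<le> latency G i (x i) (y i) (s i)"
  shows "\<exists>m\<in>{1..M}. \<exists>r\<in>feasible_routings G xbar ybar. free_flow_threshold G m r"
proof -
  have road: "i \<in> roads G" if "i \<in> {1..M}" for i using that M by (auto simp: roads_def)
  have us: "usable G i" if i: "i \<in> {1..M}" for i
    using usable_if_flow[OF G road[OF i] feasibleD(1,2)[OF f road[OF i]]] flow[OF road[OF i]] i
      feasibleD(4)[OF f road[OF i]] by auto
  have "load G (ff_latency G M) i (x i) (y i) \<le> 1" if i: "i \<in> {1..M}" for i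
  proof (cases "i = M")
    case True
    then show ?thesis
      using flow_le_max_flow_iff[OF G M us, of "x M" "y M"] feasibleD[OF f M] flow[OF M] i by auto
  next
    case False
    then have less: "i < M" using i by auto
    note r = road[OF i]
    note F = feasibleD(1,2)[OF f r]
    have z: "x i + y i > 0" using flow r less by auto
    have "load G (ff_latency G M) i (x i) (y i) \<le> load G (latency G i (x i) (y i) (s i)) i (x i) (y i)"
      by (rule load_mono[OF G r us[OF i] F lat[OF r less]])
    also have "\<dots> = 1" using congested_latency_eq_iff[OF G r us[OF i] F z, of "s i" "latency G i (x i) (y i) (s i)"]
      below[OF r less] by simp
    finally show ?thesis .
  qed
  then have "\<forall>i\<in>{1..M}. 0 \<le> x i \<and> 0 \<le> y i \<and> load G (ff_latency G M) i (x i) (y i) \<le> 1"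
    using feasibleD(1,2)[OF f road] by blast
  moreover have "\<forall>i\<in>{1..M}. usable G i" using us by blast
  ultimately obtain m x' y' where m: "m \<in> {1..M}"
    and xy: "\<forall>i\<in>{1..m}. 0 \<le> x' i \<and> 0 \<le> y' i \<and> load G (ff_latency G m) i (x' i) (y' i) \<le> 1"
    and full: "\<forall>i\<in>{1..<m}. load G (ff_latency G m) i (x' i) (y' i) = 1"
    and sums: "sum x' {1..m} = sum x {1..M}" "sum y' {1..m} = sum y {1..M}"
    using redistribute_to_threshold[OF G M] by blast
  have "x i = 0 \<and> y i = 0" if "i \<in> roads G" "i > M" for i
    using above[OF that] feasibleD(1,2)[OF f that(1)] by linarith
  then have "sum x {1..M} = sum x (roads G)" "sum y {1..M} = sum y (roads G)"
    using M by (auto simp: roads_def intro!: sum.mono_neutral_left)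
  then have "sum x' {1..m} = xbar" "sum y' {1..m} = ybar"
    using f sums by (auto simp: feasible_routings_def)
  then show ?thesis
    using feasible_threshold_routing[OF G road[OF m] _ xy full] us m by auto
qed

text \<open>
  The equilibrium is compared with the one that \<open>threshold_routing_from_congested\<close> builds from it. Optimality closes
  the chain \<open>a\<^sub>m \<le> a\<^sub>M \<le> t \<le> a\<^sub>m\<close>, and latency exactly \<open>a\<^sub>M\<close> means that \<open>M\<close> is in free-flow.
\<close>

lemma BNE_threshold:
  assumes G: "parallel_network G" and D: "xbar + ybar > 0" and b: "r \<in> BNE G xbar ybar"
  shows "\<exists>M\<in>roads G. free_flow_threshold G M r"
proof -
  obtain x y s where r: "r = (x, y, s)" by (cases r)
  have ne: "(x, y, s) \<in> nash_equilibria G xbar ybar" using b r by (auto simp: BNE_def)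
  then have f: "(x, y, s) \<in> feasible_routings G xbar ybar" by (auto simp: nash_equilibria_def)
  obtain M where M: "M \<in> roads G" "x M + y M > 0"
    and above: "\<And>i. i \<in> roads G \<Longrightarrow> i > M \<Longrightarrow> x i + y i = 0"
    and below: "\<And>i. i \<in> roads G \<Longrightarrow> i < M \<Longrightarrow> s i = 1"
    and flow: "\<And>i. i \<in> roads G \<Longrightarrow> i \<le> M \<Longrightarrow> x i + y i > 0"
    and lat: "\<And>i. i \<in> roads G \<Longrightarrow> x i + y i > 0 \<Longrightarrow>
      latency G i (x i) (y i) (s i) = latency G M (x M) (y M) (s M)"
    using nash_structure[OF G D ne] by blast
  define t where "t = latency G M (x M) (y M) (s M)"
  have t: "ff_latency G M \<le> t" unfolding t_def by (rule ff_latency_le_latency[OF G M(1) f])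
  have used: "latency G i (x i) (y i) (s i) = t" if "i \<in> roads G" "i \<le> M" for i
    using lat[OF that(1) flow[OF that]] by (simp add: t_def)
  then obtain m r' where m: "m \<in> {1..M}" and r': "r' \<in> feasible_routings G xbar ybar"
    "free_flow_threshold G m r'"
    using threshold_routing_from_congested[OF G f M(1) above below flow] t by auto
  have mr: "m \<in> roads G" using m M by (auto simp: roads_def)
  have "total_latency G (x, y, s) \<le> total_latency G r'"
    using b r threshold_routing_nash(1)[OF G mr r'] by (auto simp: BNE_def)
  then have "t * (xbar + ybar) \<le> ff_latency G m * (xbar + ybar)"
    using threshold_routing_nash(2)[OF G mr r'] total_latency_common[OF f, of t] lat
    by (simp add: t_def)
  then have "t \<le> ff_latency G m" using D by (simp add: mult_le_cancel_right)
  also have "\<dots> \<le> ff_latency G M" using ff_latency_le_iff[OF G mr M(1)] m by auto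
  finally have tM: "t = ff_latency G M" using t by simp
  then have "s M \<noteq> 1" using ff_latency_less_congested(3)[OF G M(1) f] by (auto simp: t_def)
  then have "s M = 0" using feasibleD(3)[OF f M(1)] by auto
  then have "free_flow_threshold G M r"
    using above below used[unfolded tM, OF _ less_imp_le]
    unfolding r free_flow_threshold_def prod.case by blast
  then show ?thesis using M by blast
qed

theorem theorem1:
  fixes G :: network and xbar ybar :: real
  assumes "parallel_network G"
    and "xbar \<ge> 0" and "ybar \<ge> 0"
    and "BNE G xbar ybar \<noteq> {}"
  shows "\<exists>m_EQ\<in>roads G.
    (\<forall>r\<in>BNE G xbar ybar. free_flow_threshold G m_EQ r) \<and>
    (\<exists>r\<in>feasible_routings G xbar ybar. free_flow_threshold G m_EQ r) \<and>
    (\<forall>m\<in>roads G. (\<exists>r\<in>feasible_routings G xbar ybar. free_flow_threshold G m r) \<longrightarrow> m_EQ \<le> m)"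
proof (cases "xbar + ybar > 0")
  case True
  note G = assms(1)
  have feas: "r \<in> feasible_routings G xbar ybar" if "r \<in> BNE G xbar ybar" for r
    using that by (auto simp: BNE_def nash_equilibria_def)
  obtain r0 where r0: "r0 \<in> BNE G xbar ybar" using assms(4) by blast
  then obtain M where M: "M \<in> roads G" "free_flow_threshold G M r0"
    using BNE_threshold[OF G True] by blast
  \<comment> \<open>Used for minimality, and in both directions for the uniqueness of the index.\<close>
  have least: "M' \<le> m"
    if "r' \<in> BNE G xbar ybar" "M' \<in> roads G" "free_flow_threshold G M' r'"
      and "m \<in> roads G" "r \<in> feasible_routings G xbar ybar" "free_flow_threshold G m r"
    for M' r' m r
  proof -
    have "total_latency G r' \<le> total_latency G r"
      using that(1) threshold_routing_nash(1)[OF G that(4-6)] by (auto simp: BNE_def)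
    then have "ff_latency G M' \<le> ff_latency G m"
      using threshold_routing_nash(2)[OF G that(4-6)] True
        threshold_routing_nash(2)[OF G that(2) feas[OF that(1)] that(3)]
      by (simp add: mult_le_cancel_right)
    then show ?thesis using ff_latency_le_iff[OF G that(2,4)] by simp
  qed
  have "free_flow_threshold G M r" if r: "r \<in> BNE G xbar ybar" for r
  proof -
    obtain M' where M': "M' \<in> roads G" "free_flow_threshold G M' r"
      using BNE_threshold[OF G True r] by blast
    then have "M' = M"
      using least[OF r M' M(1) feas[OF r0] M(2)] least[OF r0 M M'(1) feas[OF r] M'(2)] by simp
    then show ?thesis using M' by simp
  qed
  then show ?thesis using M least[OF r0 M] feas[OF r0] by (intro bexI[of _ M]) auto
next
  case False
  have thr: "free_flow_threshold G 1 r" if "r \<in> feasible_routings G xbar ybar" for r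
  proof -
    obtain x y s where r: "r = (x, y, s)" by (cases r)
    note f = that[unfolded r]
    have "(\<Sum>i\<in>roads G. x i + y i) = 0" using feasible_total[OF f] False assms(2,3) by simp
    then have zero: "\<forall>i\<in>roads G. x i + y i = 0"
      using feasibleD(1,2)[OF f] by (subst (asm) sum_nonneg_eq_0_iff) (auto simp: roads_def)
    moreover have "1 \<in> roads G" using assms(1) by (auto simp: parallel_network_def roads_def)
    ultimately have "s 1 = 0" using feasibleD(5)[OF f] by auto
    then show ?thesis using zero by (auto simp: r free_flow_threshold_def roads_def)
  qed
  have "BNE G xbar ybar \<subseteq> feasible_routings G xbar ybar"
    by (auto simp: BNE_def nash_equilibria_def)
  moreover have "1 \<in> roads G" using assms(1) by (auto simp: parallel_network_def roads_def)
  ultimately show ?thesis using thr assms(4) by (intro bexI[of _ 1]) (auto simp: roads_def)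
qed

end
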